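(* Let $(\mathfrak{g},[~,~],\alpha)$ be a (multiplicative) Hom-Lie algebra over $\mathbf{k}$, let $\lambda\in\mathbf{k}$, and let $R:\mathfrak{g}\to\mathfrak{g}$ be a linear map satisfying $\alpha\circ R=R\circ\alpha$. Then $R$ is a Rota-Baxter operator of weight $\lambda$ on the Hom-Lie algebra $\mathfrak{g}$ if and only if $$d_\lambda R+\tfrac12[R,R]_{\mathsf{D}}=0.$$ In particular, $R$ is a Rota-Baxter operator of weight $0$ if and only if $[R,R]_{\mathsf{D}}=0$.
   Context: All vector spaces and (multi)linear maps are over a field $\mathbf{k}$ of characteristic $0$. A (multiplicative) Hom-Lie algebra $(\mathfrak{g},[~,~],\alpha)$ is a vector space $\mathfrak{g}$ with a skew-symmetric bilinear map $[~,~]$ and a linear map $\alpha:\mathfrak{g}\to\mathfrak{g}$ such that $[\alpha(x),[y,z]]+[\alpha(y),[z,x]]+[\alpha(z),[x,y]]=0$ and $\alpha([x,y])=[\alpha(x),\alpha(y)]$. A linear map $R:\mathfrak{g}\to\mathfrak{g}$ with $\alpha\circ R=R\circ\alpha$ is a Rota-Baxter operator of weight $\lambda$ if $[Rx,Ry]=R([Rx,y]+[x,Ry]+\lambda[x,y])$ for all $x,y\in\mathfrak{g}$. For $n\ge1$, $C^n_{\mathrm{Hom}}(\mathfrak{g},\mathfrak{g})=\{f:\wedge^n\mathfrak{g}\to\mathfrak{g}\mid\alpha\circ f=f\circ\alpha^{\wedge n}\}$. $Sh(m,n)$ is the set of $(m,n)$-shuffles. For $P\in C^m_{\mathrm{Hom}}(\mathfrak{g},\mathfrak{g})$,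 $Q\in C^n_{\mathrm{Hom}}(\mathfrak{g},\mathfrak{g})$: $$(i_PQ)(x_1,\ldots,x_{m+n-1})=\sum_{\sigma\in Sh(m,n-1)}(-1)^\sigma Q\big(P(x_{\sigma(1)},\ldots,x_{\sigma(m)}),\alpha^{m-1}x_{\sigma(m+1)},\ldots,\alpha^{m-1}x_{\sigma(m+n-1)}\big),$$ $$[P,Q]_{\mathsf{C}}(x_1,\ldots,x_{m+n})=\sum_{\sigma\in Sh(m,n)}(-1)^\sigma[\alpha^{n-1}P(x_{\sigma(1)},\ldots,x_{\sigma(m)}),\alpha^{m-1}Q(x_{\sigma(m+1)},\ldots,x_{\sigma(m+n)})].$$ Let $\mu(x,y)=[x,y]$ and $\theta f=-i_f\mu$. The derived bracket is $[P,Q]_{\mathsf{D}}=[P,Q]_{\mathsf{C}}+i_{\theta P}Q-(-1)^{mn}i_{\theta Q}P$, and $d_\lambda(f)=-\lambda\,i_\mu f$. *)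

theory Defs
  imports Complex_Main "HOL-Combinatorics.Permutations"
begin

locale hom_lie_algebra = vector_space scale
  for scale :: "'k::field_char_0 \<Rightarrow> 'g::ab_group_add \<Rightarrow> 'g" +
  fixes br :: "'g \<Rightarrow> 'g \<Rightarrow> 'g"
    and \<alpha> :: "'g \<Rightarrow> 'g"
  assumes linear_br_left: "Vector_Spaces.linear scale scale (\<lambda>x. br x y)"
    and linear_br_right: "Vector_Spaces.linear scale scale (\<lambda>y. br x y)"
    and skew: "br x y = - br y x"
    and linear_alpha: "Vector_Spaces.linear scale scale \<alpha>"
    and hom_jacobi: "br (\<alpha> x) (br y z) + br (\<alpha> y) (br z x) + br (\<alpha> z) (br x y) = 0"
    and multiplicative: "\<alpha> (br x y) = br (\<alpha> x) (\<alpha> y)"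

definition rota_baxter ::
  "('k::field_char_0 \<Rightarrow> 'g::ab_group_add \<Rightarrow> 'g) \<Rightarrow> ('g \<Rightarrow> 'g \<Rightarrow> 'g) \<Rightarrow> ('g \<Rightarrow> 'g) \<Rightarrow>
    'k \<Rightarrow> ('g \<Rightarrow> 'g) \<Rightarrow> bool" where
  "rota_baxter scale br \<alpha> lam R \<longleftrightarrow>
     Vector_Spaces.linear scale scale R \<and> \<alpha> \<circ> R = R \<circ> \<alpha> \<and>
     (\<forall>x y. br (R x) (R y) = R (br (R x) y + br x (R y) + scale lam (br x y)))"

text \<open>
  A tuple \<open>(x\<^sub>1, \<dots>, x\<^sub>n)\<close> is a function \<open>x :: nat \<Rightarrow> 'g\<close> of which only the values
  \<open>x 0, \<dots>, x (n - 1)\<close> matter. A map on \<open>n\<close>-tuples has to ignore the remaining values,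
  so that equality of such maps is equality of functions. The degree of a map is not visible in
  its type and is passed to the operations below as an explicit argument.
\<close>

definition hom_cochains ::
  "('k::field_char_0 \<Rightarrow> 'g::ab_group_add \<Rightarrow> 'g) \<Rightarrow> ('g \<Rightarrow> 'g) \<Rightarrow> nat \<Rightarrow> ((nat \<Rightarrow> 'g) \<Rightarrow> 'g) set" where
  "hom_cochains scale \<alpha> n = {f.
     (\<forall>x y. (\<forall>i<n. x i = y i) \<longrightarrow> f x = f y) \<and>
     (\<forall>i<n. \<forall>x. Vector_Spaces.linear scale scale (\<lambda>v. f (x(i := v)))) \<and>
     (\<forall>x. \<forall>i<n. \<forall>j<n. i \<noteq> j \<and> x i = x j \<longrightarrow> f x = 0) \<and>
     (\<forall>x. \<alpha> (f x) = f (\<lambda>i. \<alpha> (x i)))}"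

definition shuffle_perms :: "nat \<Rightarrow> nat \<Rightarrow> (nat \<Rightarrow> nat) set" where
  "shuffle_perms m n = {\<sigma>. \<sigma> permutes {..<m + n} \<and>
     strict_mono_on {..<m} \<sigma> \<and> strict_mono_on {m..<m + n} \<sigma>}"

text \<open>
  \<open>insertion scale \<alpha> m n P Q\<close> is \<open>i\<^sub>P Q\<close> for \<open>P\<close> of degree \<open>m \<ge> 1\<close> and \<open>Q\<close> of degree \<open>n \<ge> 1\<close>.
\<close>

definition insertion ::
  "('k::field_char_0 \<Rightarrow> 'g::ab_group_add \<Rightarrow> 'g) \<Rightarrow> ('g \<Rightarrow> 'g) \<Rightarrow> nat \<Rightarrow> nat \<Rightarrow>
    ((nat \<Rightarrow> 'g) \<Rightarrow> 'g) \<Rightarrow> ((nat \<Rightarrow> 'g) \<Rightarrow> 'g) \<Rightarrow> (nat \<Rightarrow> 'g) \<Rightarrow> 'g" where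
  "insertion scale \<alpha> m n P Q = (\<lambda>x. \<Sum>\<sigma>\<in>shuffle_perms m (n - 1). scale (of_int (sign \<sigma>))
     (Q (\<lambda>i. if i = 0 then P (\<lambda>j. x (\<sigma> j))
              else (\<alpha> ^^ (m - 1)) (x (\<sigma> (m + (i - 1)))))))"

definition cup_bracket ::
  "('k::field_char_0 \<Rightarrow> 'g::ab_group_add \<Rightarrow> 'g) \<Rightarrow> ('g \<Rightarrow> 'g \<Rightarrow> 'g) \<Rightarrow> ('g \<Rightarrow> 'g) \<Rightarrow> nat \<Rightarrow> nat \<Rightarrow>
    ((nat \<Rightarrow> 'g) \<Rightarrow> 'g) \<Rightarrow> ((nat \<Rightarrow> 'g) \<Rightarrow> 'g) \<Rightarrow> (nat \<Rightarrow> 'g) \<Rightarrow> 'g" where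
  "cup_bracket scale br \<alpha> m n P Q = (\<lambda>x. \<Sum>\<sigma>\<in>shuffle_perms m n. scale (of_int (sign \<sigma>))
     (br ((\<alpha> ^^ (n - 1)) (P (\<lambda>j. x (\<sigma> j))))
         ((\<alpha> ^^ (m - 1)) (Q (\<lambda>j. x (\<sigma> (m + j)))))))"

definition bracket_cochain :: "('g \<Rightarrow> 'g \<Rightarrow> 'g) \<Rightarrow> (nat \<Rightarrow> 'g) \<Rightarrow> 'g" where
  "bracket_cochain br = (\<lambda>x. br (x 0) (x 1))"

definition theta ::
  "('k::field_char_0 \<Rightarrow> 'g::ab_group_add \<Rightarrow> 'g) \<Rightarrow> ('g \<Rightarrow> 'g \<Rightarrow> 'g) \<Rightarrow> ('g \<Rightarrow> 'g) \<Rightarrow> nat \<Rightarrow>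
    ((nat \<Rightarrow> 'g) \<Rightarrow> 'g) \<Rightarrow> (nat \<Rightarrow> 'g) \<Rightarrow> 'g" where
  "theta scale br \<alpha> m f = (\<lambda>x. - insertion scale \<alpha> m 2 f (bracket_cochain br) x)"

definition derived_bracket ::
  "('k::field_char_0 \<Rightarrow> 'g::ab_group_add \<Rightarrow> 'g) \<Rightarrow> ('g \<Rightarrow> 'g \<Rightarrow> 'g) \<Rightarrow> ('g \<Rightarrow> 'g) \<Rightarrow> nat \<Rightarrow> nat \<Rightarrow>
    ((nat \<Rightarrow> 'g) \<Rightarrow> 'g) \<Rightarrow> ((nat \<Rightarrow> 'g) \<Rightarrow> 'g) \<Rightarrow> (nat \<Rightarrow> 'g) \<Rightarrow> 'g" where
  "derived_bracket scale br \<alpha> m n P Q = (\<lambda>x. cup_bracket scale br \<alpha> m n P Q x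
     + insertion scale \<alpha> (m + 1) n (theta scale br \<alpha> m P) Q x
     - scale ((-1) ^ (m * n)) (insertion scale \<alpha> (n + 1) m (theta scale br \<alpha> n Q) P x))"

definition weight_differential ::
  "('k::field_char_0 \<Rightarrow> 'g::ab_group_add \<Rightarrow> 'g) \<Rightarrow> ('g \<Rightarrow> 'g \<Rightarrow> 'g) \<Rightarrow> ('g \<Rightarrow> 'g) \<Rightarrow> 'k \<Rightarrow> nat \<Rightarrow>
    ((nat \<Rightarrow> 'g) \<Rightarrow> 'g) \<Rightarrow> (nat \<Rightarrow> 'g) \<Rightarrow> 'g" where
  "weight_differential scale br \<alpha> lam n f =
     (\<lambda>x. - scale lam (insertion scale \<alpha> 2 n (bracket_cochain br) f x))"

definition one_cochain :: "('g \<Rightarrow> 'g) \<Rightarrow> (nat \<Rightarrow> 'g) \<Rightarrow> 'g" where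
  "one_cochain R = (\<lambda>x. R (x 0))"

lemma one_cochain_bij:
  "bij_betw one_cochain {R. Vector_Spaces.linear scale scale R \<and> \<alpha> \<circ> R = R \<circ> \<alpha>}
     (hom_cochains scale \<alpha> 1)"
proof (rule bij_betw_byWitness[where f' = "\<lambda>f v. f (\<lambda>_. v)"])
  let ?L = "{R. Vector_Spaces.linear scale scale R \<and> \<alpha> \<circ> R = R \<circ> \<alpha>}"
  have mem: "f \<in> hom_cochains scale \<alpha> 1 \<Longrightarrow>
     (\<forall>x y. (\<forall>i<1. x i = y i) \<longrightarrow> f x = f y) \<and>
     (\<forall>i<1. \<forall>x. Vector_Spaces.linear scale scale (\<lambda>v. f (x(i := v)))) \<and>
     (\<forall>x. \<alpha> (f x) = f (\<lambda>i. \<alpha> (x i)))" for f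
    unfolding hom_cochains_def mem_Collect_eq by (elim conjE) (intro conjI)
  have dep: "f x = f y" if "f \<in> hom_cochains scale \<alpha> 1" "x 0 = y 0" for f x y
    using mem[OF that(1), THEN conjunct1, rule_format, of x y] that(2)
    by (simp only: less_one simp_thms)
  show "\<forall>R\<in>?L. (\<lambda>v. one_cochain R (\<lambda>_. v)) = R"
    unfolding one_cochain_def by simp
  show "\<forall>f\<in>hom_cochains scale \<alpha> 1. one_cochain (\<lambda>v. f (\<lambda>_. v)) = f"
    unfolding one_cochain_def by (intro ballI ext, rule dep) simp_all
  show "one_cochain ` ?L \<subseteq> hom_cochains scale \<alpha> 1"
  proof (rule image_subsetI)
    fix R assume "R \<in> ?L"
    then have lin: "Vector_Spaces.linear scale scale R" and com: "\<And>v. \<alpha> (R v) = R (\<alpha> v)"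
      by (simp_all add: o_def fun_eq_iff)
    show "one_cochain R \<in> hom_cochains scale \<alpha> 1"
      unfolding hom_cochains_def one_cochain_def mem_Collect_eq
      by (intro conjI allI impI) (use lin com in simp_all)
  qed
  show "(\<lambda>f v. f (\<lambda>_. v)) ` hom_cochains scale \<alpha> 1 \<subseteq> ?L"
  proof (rule image_subsetI)
    fix f assume f: "f \<in> hom_cochains scale \<alpha> 1"
    have "(\<lambda>v. f (\<lambda>_. v)) = (\<lambda>v. f ((\<lambda>_. undefined)(0 := v)))"
      by (rule ext, rule dep[OF f]) simp
    moreover have "Vector_Spaces.linear scale scale (\<lambda>v. f ((\<lambda>_. undefined)(0 := v)))"
      using mem[OF f, THEN conjunct2, THEN conjunct1] by (simp only: less_one)
    ultimately have "Vector_Spaces.linear scale scale (\<lambda>v. f (\<lambda>_. v))"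
      by (simp only:)
    moreover have "\<alpha> (f (\<lambda>_. v)) = f (\<lambda>_. \<alpha> v)" for v
      by (rule mem[OF f, THEN conjunct2, THEN conjunct2, THEN spec])
    ultimately show "(\<lambda>v. f (\<lambda>_. v)) \<in> ?L"
      by (simp add: o_def)
  qed
qed

lemma (in hom_lie_algebra) bracket_cochain_in: "bracket_cochain br \<in> hom_cochains scale \<alpha> 2"
proof -
  have self: "br v v = 0" for v
  proof -
    have "br v v + br v v = 0"
      using skew[of v v] by (simp only: eq_neg_iff_add_eq_0)
    then have "scale (1 + 1) (br v v) = 0"
      by (simp only: scale_left_distrib scale_one)
    then show ?thesis by simp
  qed
  show ?thesis
    unfolding hom_cochains_def bracket_cochain_def mem_Collect_eq less_2_cases_iff
  proof (intro conjI allI impI)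
    show "Vector_Spaces.linear scale scale (\<lambda>v. br ((x(i := v)) 0) ((x(i := v)) 1))"
      if "i = 0 \<or> i = Suc 0" for i x
      using that linear_br_left[of "x 1"] linear_br_right[of "x 0"] by (elim disjE) simp_all
    show "br (x 0) (x 1) = 0"
      if "i = 0 \<or> i = Suc 0" "j = 0 \<or> j = Suc 0" "i \<noteq> j \<and> x i = x j" for x and i j :: nat
      using that by (elim disjE) (simp_all add: self)
  qed (simp_all add: multiplicative)
qed

end

theory Submission
  imports Defs
begin

text \<open>
  In degree one the shuffle sums have at most two terms, because
  \<open>Sh(1,1) = {id, (0 1)}\<close> and \<open>Sh(2,0) = {id}\<close>, and the twists disappear: they are \<open>\<alpha>\<^sup>0\<close>, or
  there is no argument for them to act on.
  Skew-symmetry merges the two terms of the cup bracket into \<open>2 [R x, R y]\<close> and turns \<open>\<theta> R\<close>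
  into \<open>- [R x, y] - [x, R y]\<close>. Since \<open>(-1)\<^sup>1\<^sup>\<cdot>\<^sup>1 = -1\<close>, the two insertion terms of the
  derived bracket add up instead of cancelling, and \<open>derived_bracket_one_cochain\<close> results:
  \<open>[R,R]\<^sub>D(x,y) = 2 ([R x, R y] - R ([R x, y] + [x, R y]))\<close>. Its half is the defect of the
  Rota-Baxter identity of weight zero, and \<open>d\<^sub>\<lambda> R(x,y) = - \<lambda> R [x,y]\<close> supplies the missing
  weight term. So the Maurer-Cartan expression vanishes on all pairs exactly when the
  Rota-Baxter identity holds on all pairs.
\<close>

text \<open>An increasing map of an initial segment of the naturals satisfies \<open>i \<le> \<sigma> i\<close>, and a
  permutation of the segment with this property fixes everything.\<close>

lemma shuffle_perms_right_0: "shuffle_perms m 0 = {id}"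
proof -
  have "\<sigma> = id" if p: "\<sigma> permutes {..<m}" and mono: "strict_mono_on {..<m} \<sigma>" for \<sigma>
  proof -
    have "i < m \<Longrightarrow> i \<le> \<sigma> i" for i
    proof (induction i)
      case (Suc i)
      then have "\<sigma> i < \<sigma> (Suc i)"
        by (intro strict_mono_onD[OF mono]) auto
      with Suc show ?case by linarith
    qed simp
    then show ?thesis
      using permutes_natset_ge[OF p] by auto
  qed
  then show ?thesis
    by (auto simp: shuffle_perms_def permutes_id strict_mono_on_def)
qed

lemma shuffle_perms_1_1: "shuffle_perms 1 1 = {id, Transposition.transpose 0 1}"
proof -
  have "{..<1 + 1} = {0, 1::nat}" by auto
  then show ?thesis
    by (auto simp: shuffle_perms_def strict_mono_on_def permutes_doubleton_iff)
qed

lemma sum_shuffle_perms_1_1: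
  fixes f :: "(nat \<Rightarrow> nat) \<Rightarrow> 'a::ab_group_add"
  shows "(\<Sum>\<sigma>\<in>shuffle_perms 1 1. f \<sigma>) = f id + f (Transposition.transpose 0 1)"
proof -
  have "id \<noteq> Transposition.transpose 0 (1::nat)"
    by (metis id_apply transpose_apply_first zero_neq_one)
  then show ?thesis
    unfolding shuffle_perms_1_1 by simp
qed

context hom_lie_algebra
begin

lemma cup_bracket_one_cochain:
  "cup_bracket scale br \<alpha> 1 1 (one_cochain R) (one_cochain R) x = scale 2 (br (R (x 0)) (R (x 1)))"
proof -
  have "scale 2 v = v + v" for v
    using scale_left_distrib[of 1 1 v] by simp
  then show ?thesis
    unfolding cup_bracket_def sum_shuffle_perms_1_1 one_cochain_def
    using skew[of "R (x 1)" "R (x 0)"]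
    by (simp add: sign_swap_id)
qed

lemma theta_one_cochain:
  "theta scale br \<alpha> 1 (one_cochain R) x = - (br (R (x 0)) (x 1) + br (x 0) (R (x 1)))"
proof -
  have sub: "(2::nat) - 1 = 1" by simp
  show ?thesis
    unfolding theta_def insertion_def sub sum_shuffle_perms_1_1 one_cochain_def
      bracket_cochain_def
    using skew[of "R (x 1)" "x 0"]
    by (simp add: sign_swap_id)
qed

text \<open>Inserting into a map of degree one is composition; the twist \<open>\<alpha>\<^sup>m\<^sup>-\<^sup>1\<close> has no argument
  left to act on, whatever the degree \<open>m\<close> of \<open>P\<close>.\<close>

lemma insertion_one_cochain:
  "insertion scale \<alpha> m 1 P (one_cochain R) x = R (P x)"
  by (simp add: insertion_def one_cochain_def shuffle_perms_right_0)

lemma derived_bracket_one_cochain: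
  assumes "Vector_Spaces.linear scale scale R"
  shows "derived_bracket scale br \<alpha> 1 1 (one_cochain R) (one_cochain R) x =
    scale 2 (br (R (x 0)) (R (x 1)) - R (br (R (x 0)) (x 1) + br (x 0) (R (x 1))))"
proof -
  interpret R: Vector_Spaces.linear scale scale R by (fact assms)
  have two: "scale 2 v = v + v" for v
    using scale_left_distrib[of 1 1 v] by simp
  show ?thesis
    unfolding derived_bracket_def insertion_one_cochain cup_bracket_one_cochain theta_one_cochain
    by (simp only: R.neg two) (simp add: algebra_simps)
qed

text \<open>This passes from equality of functions on tuples to the quantification over pairs in the
  Rota-Baxter identity: every pair of vectors occurs as the first two entries of a tuple.\<close>

lemma tuple_fun_eq_0_iff: "((\<lambda>x::nat \<Rightarrow> 'g. F (x 0) (x 1)) = (\<lambda>x. 0)) \<longleftrightarrow> (\<forall>u v. F u v = 0)"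
  for F :: "'g \<Rightarrow> 'g \<Rightarrow> 'g"
proof
  assume L: "(\<lambda>x::nat \<Rightarrow> 'g. F (x 0) (x 1)) = (\<lambda>x. 0)"
  have "F u v = 0" for u v
    using fun_cong[OF L, of "\<lambda>i. if i = 0 then u else v"] by simp
  then show "\<forall>u v. F u v = 0" by blast
qed simp

lemma rota_baxter_iff_maurer_cartan:
  assumes lin: "Vector_Spaces.linear scale scale R" and com: "\<alpha> \<circ> R = R \<circ> \<alpha>"
  shows "rota_baxter scale br \<alpha> lam R \<longleftrightarrow>
    (\<lambda>x. weight_differential scale br \<alpha> lam 1 (one_cochain R) x
       + scale (1 / 2) (derived_bracket scale br \<alpha> 1 1 (one_cochain R) (one_cochain R) x))
    = (\<lambda>x. 0)"
proof -
  interpret R: Vector_Spaces.linear scale scale R by (fact lin)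
  \<comment> \<open>The defect of the Rota-Baxter identity.\<close>
  define D where "D u v = br (R u) (R v) - R (br (R u) v + br u (R v) + scale lam (br u v))" for u v
  have "weight_differential scale br \<alpha> lam 1 (one_cochain R) x
      + scale (1 / 2) (derived_bracket scale br \<alpha> 1 1 (one_cochain R) (one_cochain R) x)
      = D (x 0) (x 1)" for x
    unfolding weight_differential_def insertion_one_cochain derived_bracket_one_cochain[OF lin] D_def
    by (simp add: bracket_cochain_def R.add R.scale)
  then show ?thesis
    by (simp only: tuple_fun_eq_0_iff) (simp add: rota_baxter_def lin com D_def)
qed

end

theorem mainTheorem12:
  fixes scale :: "'k::field_char_0 \<Rightarrow> 'g::ab_group_add \<Rightarrow> 'g"
    and br :: "'g \<Rightarrow> 'g \<Rightarrow> 'g"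
    and \<alpha> R :: "'g \<Rightarrow> 'g"
    and lam :: 'k
  assumes "hom_lie_algebra scale br \<alpha>"
    and "Vector_Spaces.linear scale scale R"
    and "\<alpha> \<circ> R = R \<circ> \<alpha>"
  shows "(rota_baxter scale br \<alpha> lam R \<longleftrightarrow>
           (\<lambda>x. weight_differential scale br \<alpha> lam 1 (one_cochain R) x
              + scale (1 / 2) (derived_bracket scale br \<alpha> 1 1 (one_cochain R) (one_cochain R) x))
           = (\<lambda>x. 0))
       \<and> (rota_baxter scale br \<alpha> 0 R \<longleftrightarrow>
           derived_bracket scale br \<alpha> 1 1 (one_cochain R) (one_cochain R) = (\<lambda>x. 0))"
proof -
  interpret hom_lie_algebra scale br \<alpha> by (fact assms(1))
  have "weight_differential scale br \<alpha> 0 1 (one_cochain R) x = 0" for x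
    by (simp add: weight_differential_def)
  then show ?thesis
    using rota_baxter_iff_maurer_cartan[OF assms(2,3), of lam]
      rota_baxter_iff_maurer_cartan[OF assms(2,3), of 0]
    by (simp add: fun_eq_iff)
qed

end
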